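(* Let $r, s$ be nonzero integers with $r \ge 1$ and $\gcd(r,s)=1$, and fix $n \ge 2$. Consider the Diophantine equation $$ r\left(\frac{1}{x_1} + \cdots + \frac{1}{x_n}\right) - \frac{s}{x_1 x_2 \cdots x_n} = z. $$ It has only finitely many integer solutions $(x_1, \dots, x_n, z) = (q_1, \dots, q_n, m)$ (with any integer $m$) satisfying $1 \le q_1 \le q_2 \le \cdots \le q_n$ and the side conditions $$ r q_1 \cdots q_{n-1} > s \ \text{ if } s>0, \qquad q_n > |s| \ \text{ if } s<0. $$ Furthermore, for such solutions: (1) All of them have $m \ge 1$ and satisfy $$ \max_i\{q_i\} \le \begin{cases} u_n(r) - 2 & \text{if } s>0,\\ u_n(r) + |s| - 1 & \text{if } s<0.\end{cases} $$ (2) If in addition $q_n > s^2$, then $\max_i\{q_i\} \le u_n(r) - s - 1$. Furthermore, whenever $u_n(r) > s^2$ there exist such solutions with $q_n = u_n(r) - s - 1$, so this bound is attained for all $(r,s,n)$ with $u_n(r) > s^2$.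
   Context: The sequence $u_n(r)$ is defined by $u_1(r) = r+1$ and $u_{n+1}(r) = r\left(\prod_{i=1}^n u_i(r)\right) + 1$ for $n \ge 1$.
   Formalization: For (r,s,n) = (1,1,2) the attainment claim in (2) is false as stated: the only candidate is q = (1,1), m = 1, where r q_1 > s reads 1 > 1; for this one triple only an ordered solution of the equation with q_n = u_n(r) - s - 1 is claimed, without the side condition. *)

theory Defs
  imports Complex_Main
begin

(* Indices start at 1; the value at 0 is a dummy that enters nothing else. *)
fun u_seq :: "int \<Rightarrow> nat \<Rightarrow> int" where
  "u_seq r 0 = 0"
| "u_seq r (Suc 0) = r + 1"
| "u_seq r (Suc (Suc n)) = r * (\<Prod>i\<in>{1..Suc n}. u_seq r i) + 1"

(* An n-tuple (x_1, ..., x_n) is a list of length n, so that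
   x_1 = hd x, x_n = last x and x_1 * ... * x_{n-1} = prod_list (butlast x). *)
definition solves_eq :: "int \<Rightarrow> int \<Rightarrow> int list \<Rightarrow> int \<Rightarrow> bool" where
  "solves_eq r s x z \<longleftrightarrow>
     rat_of_int r * (\<Sum>a\<leftarrow>x. 1 / rat_of_int a) - rat_of_int s / rat_of_int (prod_list x)
       = rat_of_int z"

definition ordered_solution :: "int \<Rightarrow> int \<Rightarrow> nat \<Rightarrow> int list \<Rightarrow> int \<Rightarrow> bool" where
  "ordered_solution r s n q m \<longleftrightarrow>
     length q = n \<and> 1 \<le> hd q \<and> sorted q \<and> solves_eq r s q m"

(* For r = s = 1 and n = 2 no ordered solution meets this condition, although
   s^2 = 1 < 3 = u_2(1): the only candidate with q_2 = u_2(1) - s - 1 = 1 is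
   q = (1, 1), m = 1, for which r * q_1 = s.  Attainment of the bound therefore
   cannot demand the side condition for this one triple. *)
definition side_condition :: "int \<Rightarrow> int \<Rightarrow> int list \<Rightarrow> bool" where
  "side_condition r s q \<longleftrightarrow>
     (s > 0 \<longrightarrow> r * prod_list (butlast q) > s) \<and> (s < 0 \<longrightarrow> last q > \<bar>s\<bar>)"

definition admissible_solution :: "int \<Rightarrow> int \<Rightarrow> nat \<Rightarrow> int list \<Rightarrow> int \<Rightarrow> bool" where
  "admissible_solution r s n q m \<longleftrightarrow> ordered_solution r s n q m \<and> side_condition r s q"

end

(* Write P k = u_1 ... u_k and X k = q_1 ... q_k. For either sign of s, r * X (n-1) > s,
   i.e. that the gap m - r * (1/q_1 + ... + 1/q_(n-1)) is positive; it equals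
   (r - s / X (n-1)) / q_n. A positive gap of k terms is at least 1 / X k. When X (n-1) <= P (n-1)
   this already gives q_n <= r * P (n-1) - s = u_n - s - 1. Otherwise cut the sequence at the last
   j with X j <= P j: before j use the bound 1 / X j, which is at least 1 / P j, and after j
   compare term by term with 1 / u_i via 1/u - 1/q >= ln (q/u) / q. Abel summation of the
   logarithms, whose partial sums after j are nonnegative, yields a lower bound on the gap strong
   enough for the same conclusion. So q_n <= u_n - s - 1 holds for every admissible solution,
   which contains both upper bounds. *)

theory Submission
  imports Defs
begin

section \<open>The sequence \<open>u_seq\<close>: recurrences and reciprocal sums\<close>

text \<open>A zero-based product merges the two defining equations, the empty product giving the
  initial value \<open>r + 1\<close>.\<close>

lemma u_seq_Suc: "u_seq r (Suc k) = r * (\<Prod>i<k. u_seq r (Suc i)) + 1"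
proof (cases k)
  case (Suc l)
  have "(\<Prod>i\<in>{1..Suc l}. u_seq r i) = (\<Prod>i<Suc l. u_seq r (Suc i))"
    by (rule prod.reindex_bij_witness[of _ Suc "\<lambda>i. i - 1"]) auto
  then show ?thesis using Suc by simp
qed simp

declare u_seq.simps(3) [simp del]

lemma u_seq_pos:
  assumes "r \<ge> 0"
  shows "u_seq r (Suc k) \<ge> 1"
proof (induction k rule: less_induct)
  case (less k)
  have "(\<Prod>i<k. u_seq r (Suc i)) \<ge> 0"
    using less by (intro prod_nonneg) force
  then show ?case
    using assms by (simp add: u_seq_Suc[of r k])
qed

lemma u_seq_prod_pos: "r \<ge> 0 \<Longrightarrow> (\<Prod>i<k. u_seq r (Suc i)) \<ge> 1"
  using u_seq_pos[of r] by (intro prod_ge_1) auto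

text \<open>Since \<open>r\<close> times the product of the first \<open>k\<close> terms is
  \<open>u_seq r (Suc k) - 1\<close>, the product can be eliminated. This is Sylvester's recurrence;
  \<open>r\<close> survives only in the initial value.\<close>

lemma u_seq_Suc_Suc:
  "u_seq r (Suc (Suc k)) = (u_seq r (Suc k))\<^sup>2 - u_seq r (Suc k) + 1"
  unfolding u_seq_Suc[of r "Suc k"] prod.lessThan_Suc
  by (simp add: u_seq_Suc[of r k] power2_eq_square algebra_simps)

lemma u_seq_strict_step:
  assumes "r \<ge> 1"
  shows "u_seq r (Suc k) < u_seq r (Suc (Suc k))"
proof -
  have "u_seq r (Suc k) \<ge> 2"
    using u_seq_prod_pos[of r k] assms mult_mono[of 1 r 1 "\<Prod>i<k. u_seq r (Suc i)"]
    by (simp add: u_seq_Suc[of r k])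
  then have "0 < u_seq r (Suc k) * (u_seq r (Suc k) - 2) + 1"
    by (intro add_nonneg_pos mult_nonneg_nonneg) auto
  then show ?thesis
    by (simp add: u_seq_Suc_Suc power2_eq_square algebra_simps)
qed

text \<open>Telescoping: with p the product of the first k terms and w = r p + 1 the next one, r / w
  = 1 / p - 1 / (p w).\<close>

lemma u_seq_reciprocal_sum:
  fixes r :: int
  assumes "r \<ge> 0"
  shows "real_of_int r * (\<Sum>i<k. 1 / real_of_int (u_seq r (Suc i)))
       = 1 - 1 / real_of_int (\<Prod>i<k. u_seq r (Suc i))"
proof (induction k)
  case (Suc k)
  define p where "p = real_of_int (\<Prod>i<k. u_seq r (Suc i))"
  have p: "p \<ge> 1"
    using u_seq_prod_pos[OF assms, of k] by (simp only: p_def)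
  have u: "real_of_int (u_seq r (Suc k)) = real_of_int r * p + 1"
    by (simp add: u_seq_Suc[of r k] p_def)
  have "real_of_int r * p + 1 > 0"
    using p assms by (intro add_nonneg_pos mult_nonneg_nonneg) auto
  \<comment> \<open>Abstract \<open>v\<close> and \<open>w\<close> keep the denominator atomic while
    fractions are cleared.\<close>
  then have "1 - 1 / p + v / w = 1 - 1 / (p * w)"
    if "v = real_of_int r" and "w = v * p + 1" for v w
    using p that by (simp add: divide_simps) (simp add: algebra_simps)
  then have "1 - 1 / p + real_of_int r * (1 / (real_of_int r * p + 1))
      = 1 - 1 / (p * (real_of_int r * p + 1))"
    by simp
  moreover have "real_of_int (\<Prod>i<Suc k. u_seq r (Suc i)) = p * (real_of_int r * p + 1)"
    unfolding prod.lessThan_Suc of_int_mult p_def[symmetric] u ..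
  ultimately show ?case
    using Suc.IH unfolding p_def[symmetric] by (simp only: sum.lessThan_Suc distrib_left u)
qed simp

section \<open>Lower bounds for a positive gap between \<open>m\<close> and \<open>r\<close> times a
  reciprocal sum\<close>

lemma prod_times_reciprocal_sum_Ints:
  fixes x :: "nat \<Rightarrow> int"
  assumes "\<And>i. i < k \<Longrightarrow> x i \<noteq> 0"
  shows "real_of_int (\<Prod>i<k. x i) * (\<Sum>i<k. 1 / real_of_int (x i)) \<in> \<int>"
  using assms
proof (induction k)
  case (Suc k)
  have "real_of_int (\<Prod>i<Suc k. x i) * (\<Sum>i<Suc k. 1 / real_of_int (x i))
      = real_of_int (\<Prod>i<k. x i) * (\<Sum>i<k. 1 / real_of_int (x i)) * real_of_int (x k)
        + real_of_int (\<Prod>i<k. x i)"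
    using Suc.prems[of k] by (simp add: field_simps)
  also have "\<dots> \<in> \<int>"
    using Suc by (intro Ints_add Ints_mult[OF _ Ints_of_int] Ints_of_int) auto
  finally show ?case .
qed simp

text \<open>The product of the \<open>x i\<close> is a common denominator, so the gap times this
  product is a positive integer, hence at least 1.\<close>

lemma gap_ge_inverse_prod:
  fixes x :: "nat \<Rightarrow> int" and r m :: int
  assumes pos: "\<And>i. i < k \<Longrightarrow> x i \<ge> 1"
    and gap: "real_of_int r * (\<Sum>i<k. 1 / real_of_int (x i)) < real_of_int m"
  shows "1 / real_of_int (\<Prod>i<k. x i)
       \<le> real_of_int m - real_of_int r * (\<Sum>i<k. 1 / real_of_int (x i))"
proof -
  define X where "X = real_of_int (\<Prod>i<k. x i)"
  define S where "S = (\<Sum>i<k. 1 / real_of_int (x i))"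
  have "(\<Prod>i<k. x i) > 0"
    using pos by (intro prod_pos) force
  then have X: "X > 0" by (simp only: X_def of_int_0_less_iff)
  have XS: "X * S \<in> \<int>"
    unfolding X_def S_def using pos by (intro prod_times_reciprocal_sum_Ints) force
  have "X \<in> \<int>"
    unfolding X_def by (rule Ints_of_int)
  then have "X * real_of_int m - real_of_int r * (X * S) \<in> \<int>"
    by (rule Ints_diff[OF Ints_mult[OF _ Ints_of_int] Ints_mult[OF Ints_of_int XS]])
  then obtain d where d: "X * (real_of_int m - real_of_int r * S) = real_of_int d"
    by (auto elim!: Ints_cases simp: algebra_simps)
  have "X * (real_of_int m - real_of_int r * S) > 0"
    using X gap by (simp add: S_def)
  then have "X * (real_of_int m - real_of_int r * S) \<ge> 1"
    using d by simp
  then show ?thesis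
    using X unfolding X_def[symmetric] S_def[symmetric] by (simp add: field_simps)
qed

text \<open>Lowering the common weight from \<open>y k\<close> to \<open>y (Suc k)\<close> can only
  decrease the left side, because the partial sum it multiplies is nonnegative. The full sum up to
  \<open>k\<close> may have either sign.\<close>

lemma Abel_lower_bound:
  fixes y a :: "nat \<Rightarrow> real"
  assumes "j \<le> k"
    and "\<And>i. j \<le> i \<Longrightarrow> i < k \<Longrightarrow> y (Suc i) \<le> y i"
    and "\<And>l. j \<le> l \<Longrightarrow> l < k \<Longrightarrow> 0 \<le> (\<Sum>i=j..l. a i)"
  shows "y k * (\<Sum>i=j..k. a i) \<le> (\<Sum>i=j..k. y i * a i)"
  using assms
proof (induction k rule: dec_induct)
  case (step k)
  have "y (Suc k) * (\<Sum>i=j..k. a i) \<le> y k * (\<Sum>i=j..k. a i)"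
    using step by (intro mult_right_mono) auto
  also have "\<dots> \<le> (\<Sum>i=j..k. y i * a i)"
    using step by auto
  finally show ?case
    using step.hyps by (simp add: distrib_left)
qed simp

text \<open>
  The correction term below is what replaces the crude bound \<open>1 / \<Prod>u\<close> on the gap: it is
  positive exactly when the product of the \<open>x i\<close> exceeds that of the \<open>u i\<close>.
\<close>

lemma gap_lower_bound:
  fixes x :: "nat \<Rightarrow> int" and r m :: int
  defines "P \<equiv> \<lambda>k. real_of_int (\<Prod>i<k. u_seq r (Suc i))"
    and "X \<equiv> \<lambda>k. real_of_int (\<Prod>i<k. x i)"
  assumes r: "r \<ge> 1"
    and pos: "\<And>i. i \<le> k \<Longrightarrow> x i \<ge> 1"
    and mono: "\<And>i. i < k \<Longrightarrow> x i \<le> x (Suc i)"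
    and gap: "real_of_int r * (\<Sum>i<Suc k. 1 / real_of_int (x i)) < real_of_int m"
  shows "1 / P (Suc k) + real_of_int r / real_of_int (x k) * (1 - P (Suc k) / X (Suc k))
       \<le> real_of_int m - real_of_int r * (\<Sum>i<Suc k. 1 / real_of_int (x i))"
proof -
  define u where "u = (\<lambda>i. real_of_int (u_seq r (Suc i)))"
  define y where "y = (\<lambda>i. real_of_int (x i))"
  define a where "a = (\<lambda>i. ln (y i / u i))"
  have u: "u i > 0" for i
    using u_seq_pos[of r i] r by (simp add: u_def)
  have y: "y i > 0" if "i \<le> k" for i
    using pos[OF that] by (simp add: y_def)
  have P: "P l > 0" for l
    unfolding P_def using u by (simp add: u_def prod_pos)
  have X: "X l > 0" if "l \<le> Suc k" for l
    unfolding X_def of_int_prod using y that by (intro prod_pos) (auto simp: y_def)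
  have lnR: "ln (X l / P l) = (\<Sum>i<l. a i)" if "l \<le> Suc k" for l
  proof -
    have "ln (X l / P l) = ln (\<Prod>i<l. y i / u i)"
      by (simp add: X_def P_def y_def u_def prod_dividef)
    also have "\<dots> = (\<Sum>i<l. a i)"
      unfolding a_def
    proof (rule ln_prod)
      fix i assume "i \<in> {..<l}"
      then show "y i / u i \<noteq> 0"
        using y[of i] u[of i] that by auto
    qed simp
    finally show ?thesis .
  qed
  \<comment> \<open>The cut index. The value 0 qualifies because both products are empty, and
    \<open>j \<le> k\<close> keeps the tail \<open>{j..k}\<close> nonempty.\<close>
  define j where "j = (GREATEST j. j \<le> k \<and> X j \<le> P j)"
  have "0 \<le> k \<and> X 0 \<le> P 0" by (simp add: X_def P_def)
  then have "j \<le> k \<and> X j \<le> P j"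
    unfolding j_def by (rule GreatestI_nat[where b = k]) auto
  then have j: "j \<le> k" "X j \<le> P j" by auto
  have jmax: "P l < X l" if "j < l" "l \<le> k" for l
    using Greatest_le_nat[of "\<lambda>j. j \<le> k \<and> X j \<le> P j" l k] that
    unfolding j_def[symmetric] by force
  have split: "(\<Sum>i<Suc l. f i) = (\<Sum>i<j. f i) + (\<Sum>i=j..l. f i)" if "j \<le> l"
    for f :: "nat \<Rightarrow> real" and l
    using that by (metis (no_types) atLeast0LessThan atLeastLessThanSuc_atLeastAtMost le_Suc_eq
        sum.atLeastLessThan_concat zero_le)
  have lnj: "(\<Sum>i<j. a i) \<le> 0"
    using lnR[of j] j X[of j] P[of j] by (metis divide_le_eq_1_pos divide_pos_pos le_SucI ln_le_zero_iff)
  \<comment> \<open>All logarithms up to \<open>l\<close> sum to a positive number by maximality of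
    \<open>j\<close>, and those before \<open>j\<close> contribute at most 0.\<close>
  have tail_nonneg: "0 \<le> (\<Sum>i=j..l. a i)" if "j \<le> l" "l < k" for l
  proof -
    have "0 \<le> ln (X (Suc l) / P (Suc l))"
      using jmax[of "Suc l"] that P[of "Suc l"] by simp
    then show ?thesis
      using lnR[of "Suc l"] lnj split[OF that(1), of a] that by simp
  qed
  define c where "c = X (Suc k) / P (Suc k)"
  have c: "c > 0"
    unfolding c_def using X P by simp
  \<comment> \<open>This is ln t <= t - 1 at t = 1 / c.\<close>
  have "1 - 1 / c \<le> ln c"
    using ln_le_minus_one[of "1 / c"] c by (simp add: ln_div)
  also have "\<dots> \<le> (\<Sum>i=j..k. a i)"
    using lnR[of "Suc k"] lnj split[OF j(1), of a] by (simp add: c_def)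
  finally have "(1 / y k) * (1 - 1 / c) \<le> (1 / y k) * (\<Sum>i=j..k. a i)"
    using y[of k] by (intro mult_left_mono) auto
  also have "\<dots> \<le> (\<Sum>i=j..k. (1 / y i) * a i)"
  proof (rule Abel_lower_bound[OF j(1)])
    show "1 / y (Suc i) \<le> 1 / y i" if "j \<le> i" "i < k" for i
      using mono[OF that(2)] y[of i] that by (intro divide_left_mono) (auto simp: y_def)
  qed (use tail_nonneg in auto)
  also have "\<dots> \<le> (\<Sum>i=j..k. 1 / u i - 1 / y i)"
  proof (rule sum_mono)
    fix i assume "i \<in> {j..k}"
    then have yi: "y i > 0" using y by simp
    \<comment> \<open>Again ln t <= t - 1, now at t = y / u: each weighted logarithm is at most the
      difference of the two reciprocals.\<close>
    have "(1 / y i) * a i \<le> (1 / y i) * (y i / u i - 1)"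
      unfolding a_def using yi u[of i] by (intro mult_left_mono ln_le_minus_one) auto
    also have "\<dots> = 1 / u i - 1 / y i"
      using yi u[of i] by (simp add: field_simps)
    finally show "(1 / y i) * a i \<le> 1 / u i - 1 / y i" .
  qed
  finally have "real_of_int r * ((1 / y k) * (1 - 1 / c))
      \<le> real_of_int r * (\<Sum>i=j..k. 1 / u i - 1 / y i)"
    using r by (intro mult_left_mono) auto
  then have tail: "real_of_int r / y k * (1 - 1 / c)
      \<le> real_of_int r * (\<Sum>i=j..k. 1 / u i) - real_of_int r * (\<Sum>i=j..k. 1 / y i)"
    by (simp add: sum_subtractf right_diff_distrib)
  have recip: "real_of_int r * (\<Sum>i<l. 1 / u i) = 1 - 1 / P l" for l
    unfolding u_def P_def using r by (intro u_seq_reciprocal_sum) simp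
  \<comment> \<open>Dropping the tail keeps the gap positive, so the integrality bound applies to
    the first \<open>j\<close> terms alone.\<close>
  have "(\<Sum>i=j..k. 1 / y i) \<ge> 0"
    using y by (intro sum_nonneg) (auto intro: less_imp_le)
  then have "real_of_int r * (\<Sum>i<j. 1 / y i) \<le> real_of_int r * (\<Sum>i<Suc k. 1 / y i)"
    using r unfolding split[OF j(1)] by (intro mult_left_mono) auto
  then have "real_of_int r * (\<Sum>i<j. 1 / real_of_int (x i)) < real_of_int m"
    using gap unfolding y_def by linarith
  then have "1 / X j \<le> real_of_int m - real_of_int r * (\<Sum>i<j. 1 / y i)"
    unfolding X_def y_def using pos j(1) by (intro gap_ge_inverse_prod) auto
  moreover have "1 / P j \<le> 1 / X j"
    using X[of j] j by (intro divide_left_mono) (auto intro: mult_pos_pos P)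
  ultimately have "1 / P j \<le> real_of_int m - real_of_int r * (\<Sum>i<j. 1 / y i)"
    by linarith
  moreover have "real_of_int r * (\<Sum>i<Suc k. 1 / y i)
      = real_of_int r * (\<Sum>i<j. 1 / y i) + real_of_int r * (\<Sum>i=j..k. 1 / y i)"
    unfolding split[OF j(1)] by (rule distrib_left)
  \<comment> \<open>The telescoped \<open>u\<close>-sum over the tail turns the head bound
    \<open>1 / P j\<close> into \<open>1 / P (Suc k)\<close>.\<close>
  moreover have "1 - 1 / P (Suc k) = 1 - 1 / P j + real_of_int r * (\<Sum>i=j..k. 1 / u i)"
    unfolding recip[symmetric] split[OF j(1)] by (rule distrib_left)
  ultimately have "1 / P (Suc k) + real_of_int r / y k * (1 - 1 / c)
      \<le> real_of_int m - real_of_int r * (\<Sum>i<Suc k. 1 / y i)"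
    using tail by linarith
  then show ?thesis
    by (simp only: c_def y_def divide_divide_eq_right mult_1)
qed

section \<open>Upper bound for the last entry\<close>

text \<open>The equation expresses the gap left by all terms but the last as (r X - s) / (X y),
  where y is the last term and X the product of the others. Positivity of this gap gives
  \<open>m \<ge> 1\<close>, and each lower bound on it limits y from above.\<close>

lemma last_term_bound:
  fixes x :: "nat \<Rightarrow> int" and r s m :: int
  assumes r: "r \<ge> 1"
    and pos: "\<And>i. i \<le> Suc k \<Longrightarrow> x i \<ge> 1"
    and mono: "\<And>i. i \<le> k \<Longrightarrow> x i \<le> x (Suc i)"
    and side: "s < r * (\<Prod>i<Suc k. x i)"
    and eq: "real_of_int r * (\<Sum>i<Suc (Suc k). 1 / real_of_int (x i))
        - real_of_int s / real_of_int (\<Prod>i<Suc (Suc k). x i) = real_of_int m"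
  shows "m \<ge> 1" and "x (Suc k) \<le> u_seq r (Suc (Suc k)) - s - 1"
proof -
  define X where "X = real_of_int (\<Prod>i<Suc k. x i)"
  define P where "P = real_of_int (\<Prod>i<Suc k. u_seq r (Suc i))"
  define S where "S = (\<Sum>i<Suc k. 1 / real_of_int (x i))"
  define y where "y = real_of_int (x (Suc k))"
  define R where "R = real_of_int r"
  define \<sigma> where "\<sigma> = real_of_int s"
  have "(\<Prod>i<Suc k. x i) \<ge> 1"
    using pos by (intro prod_ge_1) auto
  then have "(\<Prod>i<Suc k. x i) > 0" by linarith
  then have X: "X > 0" by (simp only: X_def of_int_0_less_iff)
  have P: "P > 0"
    using u_seq_prod_pos[of r "Suc k"] r unfolding P_def of_int_0_less_iff by linarith
  have y: "y > 0" using pos[of "Suc k"] by (simp add: y_def)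
  have R: "R \<ge> 1" using r by (simp add: R_def)
  have side': "\<sigma> < R * X"
    unfolding \<sigma>_def R_def X_def of_int_mult[symmetric] of_int_less_iff by (rule side)
  have S: "S \<ge> 0"
    unfolding S_def
  proof (rule sum_nonneg)
    fix i assume "i \<in> {..<Suc k}"
    then show "0 \<le> 1 / real_of_int (x i)"
      using pos[of i] by simp
  qed
  have "real_of_int (\<Prod>i<Suc (Suc k). x i) = X * y"
    unfolding X_def y_def prod.lessThan_Suc[of x "Suc k"] by (rule of_int_mult)
  moreover have "(\<Sum>i<Suc (Suc k). 1 / real_of_int (x i)) = S + 1 / y"
    unfolding S_def y_def by (rule sum.lessThan_Suc)
  ultimately have "R * (S + 1 / y) - \<sigma> / (X * y) = real_of_int m"
    using eq by (simp only: R_def \<sigma>_def)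
  then have gap_eq: "real_of_int m - R * S = (R * X - \<sigma>) / (X * y)"
    using X by (simp add: diff_divide_distrib distrib_left)
  have gap: "R * S < real_of_int m"
  proof -
    have "(R * X - \<sigma>) / (X * y) > 0" using side' X y by simp
    then show ?thesis using gap_eq by linarith
  qed
  have "0 \<le> R * S" using R S by simp
  then have "real_of_int m > 0" using gap by linarith
  then show "m \<ge> 1" by simp
  have "y \<le> R * P - \<sigma>"
  proof (cases "X \<le> P")
    case True
    have "1 / X \<le> real_of_int m - R * S"
      unfolding X_def R_def S_def using gap pos
      by (intro gap_ge_inverse_prod) (auto simp: R_def S_def)
    then have "y \<le> R * X - \<sigma>"
      using X y unfolding gap_eq by (simp add: field_simps)
    also have "\<dots> \<le> R * P - \<sigma>"
      using True R by simp
    finally show ?thesis .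
  next
    case False
    have "1 / P + R / real_of_int (x k) * (1 - P / X) \<le> real_of_int m - R * S"
      unfolding X_def P_def R_def S_def
      by (rule gap_lower_bound[OF r]) (use pos mono gap in \<open>auto simp: R_def S_def\<close>)
    \<comment> \<open>Enlarging the denominator from \<open>x k\<close> to \<open>y\<close> weakens
      the correction, whose second factor is positive as \<open>X > P\<close>.\<close>
    moreover have "R / y * (1 - P / X) \<le> R / real_of_int (x k) * (1 - P / X)"
      using False X R y pos[of k] mono[of k]
      by (intro mult_right_mono divide_left_mono) (auto simp: y_def)
    ultimately have "1 / P + R / y * (1 - P / X) \<le> (R * X - \<sigma>) / (X * y)"
      unfolding gap_eq by linarith
    \<comment> \<open>Clear denominators; \<open>R * P * X\<close> then cancels on both
      sides.\<close>
    then have "(1 / P + R / y * (1 - P / X)) * (P * X * y) \<le> (R * X - \<sigma>) / (X * y) * (P * X * y)"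
      using X P y by (intro mult_right_mono) auto
    moreover have "(1 / P + R / y * (1 - P / X)) * (P * X * y) = X * y + R * P * (X - P)"
      using X P y by (simp add: field_simps)
    moreover have "(R * X - \<sigma>) / (X * y) * (P * X * y) = P * (R * X - \<sigma>)"
      using X y by simp
    ultimately have *: "y * X \<le> P * (R * P - \<sigma>)"
      by (simp add: algebra_simps)
    \<comment> \<open>The sign, forced by \<open>y * X > 0\<close>, permits replacing the factor
      \<open>P\<close> by the larger \<open>X\<close>, which is then cancelled.\<close>
    then have "R * P - \<sigma> \<ge> 0"
      using X P y by (metis less_eq_real_def mult_pos_pos order_less_le_trans zero_less_mult_pos)
    then have "P * (R * P - \<sigma>) \<le> X * (R * P - \<sigma>)"
      using False by (intro mult_right_mono) auto
    with * have "X * y \<le> X * (R * P - \<sigma>)" by (simp add: mult.commute)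
    then show ?thesis using X by simp
  qed
  then have "x (Suc k) \<le> r * (\<Prod>i<Suc k. u_seq r (Suc i)) - s"
    unfolding y_def R_def P_def \<sigma>_def
    by (simp only: of_int_mult[symmetric] of_int_diff[symmetric] of_int_le_iff)
  then show "x (Suc k) \<le> u_seq r (Suc (Suc k)) - s - 1"
    by (simp only: u_seq_Suc[of r "Suc k"])
qed

section \<open>Transfer to lists, and finiteness\<close>

lemma prod_list_lessThan: "prod_list q = (\<Prod>i<length q. q ! i)"
  by (induction q) (auto simp: prod.lessThan_Suc_shift simp del: prod.lessThan_Suc)

text \<open>The equation is stated over the rationals, but the estimates use logarithms;
  \<open>of_rat\<close> is an injective field embedding, so nothing changes over the reals.\<close>

lemma solves_eq_real:
  "solves_eq r s q m \<longleftrightarrow>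
    real_of_int r * (\<Sum>i<length q. 1 / real_of_int (q ! i))
      - real_of_int s / real_of_int (\<Prod>i<length q. q ! i) = real_of_int m"
proof -
  have "solves_eq r s q m \<longleftrightarrow>
      (of_rat (rat_of_int r * (\<Sum>i<length q. 1 / rat_of_int (q ! i))
        - rat_of_int s / rat_of_int (\<Prod>i<length q. q ! i)) :: real) = of_rat (rat_of_int m)"
    unfolding solves_eq_def of_rat_eq_iff prod_list_lessThan
    by (simp add: sum_list_sum_nth atLeast0LessThan)
  then show ?thesis
    by (simp add: of_rat_diff of_rat_mult of_rat_divide of_rat_sum del: of_int_prod)
qed

lemma sorted_hd_le_mem:
  fixes q :: "int list"
  assumes "sorted q" and "x \<in> set q"
  shows "hd q \<le> x"
  using assms by (cases q) auto

lemma sorted_Max_eq_last: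
  fixes q :: "int list"
  assumes "sorted q" and "q \<noteq> []"
  shows "Max (set q) = last q"
proof (rule Max_eqI)
  fix y assume "y \<in> set q"
  then show "y \<le> last q"
    using assms by (cases q rule: rev_cases) (auto simp: sorted_append)
qed (use assms in auto)

lemma prod_list_butlast: "prod_list (butlast q) = (\<Prod>i<length q - 1. q ! i)"
  unfolding prod_list_lessThan by (simp add: nth_butlast)

lemma admissible_bound:
  assumes r: "r \<ge> 1" and n: "n \<ge> 2" and adm: "admissible_solution r s n q m"
  shows "m \<ge> 1" and "Max (set q) \<le> u_seq r n - s - 1"
proof -
  obtain k where k: "n = Suc (Suc k)"
    using n by (metis add_2_eq_Suc le_Suc_ex)
  have q: "length q = Suc (Suc k)" "1 \<le> hd q" "sorted q" "solves_eq r s q m"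
    and sc: "side_condition r s q"
    using adm by (auto simp: admissible_solution_def ordered_solution_def k)
  have pos: "q ! i \<ge> 1" if "i \<le> Suc k" for i
    using sorted_hd_le_mem[OF q(3), of "q ! i"] q(1,2) that by auto
  have mono: "q ! i \<le> q ! Suc i" if "i \<le> k" for i
    using q(1,3) that by (simp add: sorted_iff_nth_Suc)
  have "(\<Prod>i<Suc k. q ! i) \<ge> 1"
    using pos by (intro prod_ge_1) auto
  then have "r * (\<Prod>i<Suc k. q ! i) > 0" using r by (intro mult_pos_pos) linarith+
  \<comment> \<open>For positive \<open>s\<close> this is the side condition; otherwise it follows
    from the positivity just shown.\<close>
  moreover have "s > 0 \<Longrightarrow> s < r * (\<Prod>i<Suc k. q ! i)"
    using sc unfolding side_condition_def prod_list_butlast q(1) by simp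
  ultimately have side: "s < r * (\<Prod>i<Suc k. q ! i)" by linarith
  note eq = q(4)[unfolded solves_eq_real q(1)]
  show "m \<ge> 1" by (rule last_term_bound(1)[OF r pos mono side eq])
  have "q ! Suc k \<le> u_seq r (Suc (Suc k)) - s - 1"
    by (rule last_term_bound(2)[OF r pos mono side eq])
  moreover have "Max (set q) = q ! Suc k"
    using sorted_Max_eq_last[OF q(3)] q(1) last_conv_nth[of q] by force
  ultimately show "Max (set q) \<le> u_seq r n - s - 1" by (simp only: k)
qed

lemma finite_admissible:
  assumes "r \<ge> 1" and "n \<ge> 2"
  shows "finite {(q, m). admissible_solution r s n q m}" (is "finite ?A")
proof (rule finite_imageD)
  have "fst ` ?A \<subseteq> {q. set q \<subseteq> {1..u_seq r n - s - 1} \<and> length q = n}"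
  proof clarify
    fix q m assume adm: "admissible_solution r s n q m"
    then have q: "length q = n" "1 \<le> hd q" "sorted q"
      by (auto simp: admissible_solution_def ordered_solution_def)
    have "y \<in> {1..u_seq r n - s - 1}" if "y \<in> set q" for y
      using sorted_hd_le_mem[OF q(3) that] q(2) admissible_bound(2)[OF assms adm]
        Max_ge[OF finite_set that] by auto
    then show "set (fst (q, m)) \<subseteq> {1..u_seq r n - s - 1} \<and> length (fst (q, m)) = n"
      using q(1) by auto
  qed
  then show "finite (fst ` ?A)"
    by (rule finite_subset) (intro finite_lists_length_eq finite_atLeastAtMost_int)
  \<comment> \<open>The equation determines \<open>m\<close> from \<open>q\<close>, so finitely many
    lists suffice.\<close>
  show "inj_on fst ?A"
    by (auto simp: inj_on_def admissible_solution_def ordered_solution_def solves_eq_def)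
qed

section \<open>Attainment of the bound\<close>

text \<open>The witness is u_1, ..., u_(n-1) followed by b = u_n - s - 1. With P = u_1 ... u_(n-1),
  the first n - 1 terms leave the gap 1 / P below 1; since b = r P - s, the remaining contribution
  (r P - s) / (P b) fills it exactly. The excluded triple is where b < u_(n-1).\<close>

lemma bound_attained:
  assumes r: "r \<ge> 1" and n: "n \<ge> 2" and large: "u_seq r n > s\<^sup>2"
    and ne: "(r, s, n) \<noteq> (1, 1, 2)"
  shows "\<exists>q. admissible_solution r s n q 1 \<and> last q = u_seq r n - s - 1"
proof -
  obtain k where k: "n = Suc (Suc k)"
    using n by (metis add_2_eq_Suc le_Suc_ex)
  define p where "p = (\<Prod>i<k. u_seq r (Suc i))"
  define a where "a = u_seq r (Suc k)"
  define b where "b = u_seq r n - s - 1"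
  define q where "q = map (\<lambda>i. u_seq r (Suc i)) [0..<Suc k] @ [b]"
  have p: "p \<ge> 1" unfolding p_def using r by (intro u_seq_prod_pos) simp
  have ap: "a = r * p + 1" by (simp add: a_def p_def u_seq_Suc[of r k])
  have un: "u_seq r n = a\<^sup>2 - a + 1" unfolding k a_def by (rule u_seq_Suc_Suc)
  have "r * p \<ge> 1" using r p mult_mono[of 1 r 1 p] by simp
  then have a2: "a \<ge> 2" using ap by simp
  \<comment> \<open>By Sylvester's recurrence u_n = a^2 - a + 1, which is below a^2 for a >=
    2.\<close>
  have "s\<^sup>2 < a\<^sup>2" using large un a2 by simp
  then have s_less: "\<bar>s\<bar> < a"
    using a2 abs_square_less_1 power2_less_imp_less[of "\<bar>s\<bar>" a] by simp
  have ab: "a \<le> b"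
  \<comment> \<open>The tight case: \<open>a = 2\<close> forces \<open>r = 1\<close> and
    \<open>n = 2\<close>, because a predecessor v of \<open>a\<close> would satisfy v (v - 1) = 1.
    Excluding the exceptional triple then leaves \<open>s \<le> 0\<close>.\<close>
  proof (cases "a = 2")
    case True
    then have "r * p = 1" using ap by simp
    then have r1: "r = 1" and "p = 1" using r p by (auto simp: pos_zmult_eq_1_iff)
    have "k = 0"
    proof (rule ccontr)
      assume "k \<noteq> 0"
      then obtain l where l: "k = Suc l" by (cases k) auto
      have "u_seq r (Suc l) \<ge> 1" using r by (intro u_seq_pos) simp
      then have "u_seq r (Suc l) * (u_seq r (Suc l) - 1) = 1 \<and> u_seq r (Suc l) \<ge> 1"
        using True unfolding a_def l u_seq_Suc_Suc by (simp add: power2_eq_square algebra_simps)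
      then show False by (auto simp: pos_zmult_eq_1_iff)
    qed
    then have "s \<noteq> 1" using ne r1 k by auto
    then have "s \<le> 0" using s_less True by linarith
    then show ?thesis using True un by (simp add: b_def)
  next
    case False
    \<comment> \<open>Here a >= 3, and s < a gives b = a^2 - a - s > a (a - 2) >= a.\<close>
    then have "a * 1 \<le> a * (a - 2)" using a2 by (intro mult_left_mono) auto
    then show ?thesis using s_less un by (simp add: b_def power2_eq_square algebra_simps)
  qed
  have len: "length q = Suc (Suc k)" by (simp add: q_def)
  have qi: "q ! i = u_seq r (Suc i)" if "i \<le> k" for i
    using that nth_map[of i "[0..<Suc k]" "\<lambda>i. u_seq r (Suc i)"]
    by (simp add: q_def nth_append less_Suc_eq_le del: upt_Suc)
  have qk: "q ! Suc k = b" by (simp add: q_def nth_append)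
  have "sorted q"
    unfolding sorted_iff_nth_Suc len
  proof (intro allI impI)
    fix i assume "Suc i < Suc (Suc k)"
    then consider "i < k" | "i = k" by linarith
    then show "q ! i \<le> q ! Suc i"
    proof cases
      case 1
      then show ?thesis using qi u_seq_strict_step[OF r, of i] by simp
    next
      case 2
      then show ?thesis using qi[of k] qk ab by (simp add: a_def)
    qed
  qed
  moreover have "1 \<le> hd q"
    using hd_conv_nth[of q] qi[of 0] len r by force
  moreover have "solves_eq r s q 1"
  proof -
    define P where "P = real_of_int (\<Prod>i<Suc k. u_seq r (Suc i))"
    define B where "B = real_of_int b"
    have P: "P > 0"
      using u_seq_prod_pos[of r "Suc k"] r unfolding P_def of_int_0_less_iff by linarith
    have B: "B > 0" using ab a2 by (simp add: B_def)
    have "b = r * (\<Prod>i<Suc k. u_seq r (Suc i)) - s"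
      unfolding b_def k u_seq_Suc[of r "Suc k"] by simp
    then have BP: "B = real_of_int r * P - real_of_int s"
      by (simp only: B_def P_def of_int_mult of_int_diff)
    have sum: "real_of_int r * (\<Sum>i<Suc k. 1 / real_of_int (q ! i)) = 1 - 1 / P"
      unfolding P_def using u_seq_reciprocal_sum[of r "Suc k"] r qi by simp
    have "(\<Prod>i<Suc k. q ! i) = (\<Prod>i<Suc k. u_seq r (Suc i))"
      using qi by (intro prod.cong) auto
    then have "real_of_int (\<Prod>i<length q. q ! i) = P * B"
      unfolding len prod.lessThan_Suc[of _ "Suc k"] qk by (simp only: P_def B_def of_int_mult)
    moreover have "(\<Sum>i<length q. 1 / real_of_int (q ! i))
        = (\<Sum>i<Suc k. 1 / real_of_int (q ! i)) + 1 / B"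
      unfolding len sum.lessThan_Suc[of _ "Suc k"] qk B_def ..
    moreover have "1 - 1 / P + real_of_int r * (1 / B) - real_of_int s / (P * B) = 1"
    proof -
      have "real_of_int r * (1 / B) - real_of_int s / (P * B)
          = (real_of_int r * P - real_of_int s) / (P * B)"
        using P B by (simp add: field_simps)
      also have "\<dots> = 1 / P" using B by (simp add: BP[symmetric])
      finally show ?thesis by linarith
    qed
    ultimately show ?thesis
      unfolding solves_eq_real by (simp only: distrib_left sum of_int_1)
  qed
  moreover have "side_condition r s q"
  proof -
    have "r * prod_list (butlast q) = r * (\<Prod>i<Suc k. u_seq r (Suc i))"
      unfolding prod_list_butlast len using qi by simp
    also have "\<dots> = a * (a - 1)"
      using un unfolding k u_seq_Suc[of r "Suc k"] by (simp add: power2_eq_square algebra_simps)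
    finally have *: "r * prod_list (butlast q) = a * (a - 1)" .
    have "s < a" using s_less by simp
    also have "\<dots> \<le> 2 * (a - 1)" using a2 by simp
    also have "\<dots> \<le> a * (a - 1)" using a2 by (intro mult_right_mono) auto
    finally have "s < r * prod_list (butlast q)" by (simp only: *)
    moreover have "last q > \<bar>s\<bar>" using s_less ab by (simp add: q_def)
    ultimately show ?thesis unfolding side_condition_def by blast
  qed
  moreover have "last q = u_seq r n - s - 1" by (simp add: q_def b_def)
  ultimately show ?thesis
    using len by (auto simp: admissible_solution_def ordered_solution_def k)
qed

theorem theorem3p1:
  fixes r s :: int and n :: nat
  assumes "r \<ge> 1" and "s \<noteq> 0" and "gcd r s = 1" and "n \<ge> 2"
  shows "finite {(q, m). admissible_solution r s n q m} \<and>
    (\<forall>q m. admissible_solution r s n q m \<longrightarrow>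
       m \<ge> 1 \<and>
       Max (set q) \<le> (if s > 0 then u_seq r n - 2 else u_seq r n + \<bar>s\<bar> - 1)) \<and>
    (\<forall>q m. admissible_solution r s n q m \<and> last q > s^2 \<longrightarrow>
       Max (set q) \<le> u_seq r n - s - 1) \<and>
    (u_seq r n > s^2 \<longrightarrow>
       (\<exists>q m. ordered_solution r s n q m \<and>
          ((r, s, n) \<noteq> (1, 1, 2) \<longrightarrow> admissible_solution r s n q m) \<and>
          last q = u_seq r n - s - 1))"
proof (intro conjI)
  show "finite {(q, m). admissible_solution r s n q m}"
    using assms(1,4) by (rule finite_admissible)
  show "\<forall>q m. admissible_solution r s n q m \<longrightarrow>
       m \<ge> 1 \<and>
       Max (set q) \<le> (if s > 0 then u_seq r n - 2 else u_seq r n + \<bar>s\<bar> - 1)"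
    \<comment> \<open>The common bound u_n - s - 1 is at most u_n - 2 for s >= 1 and equals u_n +
      |s| - 1 for s < 0.\<close>
    using admissible_bound[OF assms(1,4)] by fastforce
  show "\<forall>q m. admissible_solution r s n q m \<and> last q > s^2 \<longrightarrow>
       Max (set q) \<le> u_seq r n - s - 1"
    using admissible_bound(2)[OF assms(1,4)] by blast
  show "u_seq r n > s^2 \<longrightarrow>
       (\<exists>q m. ordered_solution r s n q m \<and>
          ((r, s, n) \<noteq> (1, 1, 2) \<longrightarrow> admissible_solution r s n q m) \<and>
          last q = u_seq r n - s - 1)"
  proof
    assume large: "u_seq r n > s^2"
    show "\<exists>q m. ordered_solution r s n q m \<and>
          ((r, s, n) \<noteq> (1, 1, 2) \<longrightarrow> admissible_solution r s n q m) \<and>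
          last q = u_seq r n - s - 1"
    proof (cases "(r, s, n) = (1, 1, 2)")
      case True
      \<comment> \<open>As u_2(1) = 3, the required last entry is 1, and 1/1 + 1/1 - 1/1 =
        1.\<close>
      then have "ordered_solution r s n [1, 1] 1 \<and> last [1, 1] = u_seq r n - s - 1"
        by (simp add: ordered_solution_def solves_eq_def numeral_2_eq_2 u_seq_Suc[of 1 "Suc 0"])
      then show ?thesis using True by blast
    next
      case False
      then show ?thesis
        using bound_attained[OF assms(1,4) large]
        by (auto simp: admissible_solution_def)
    qed
  qed
qed

end
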